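(* Let $\Gamma\subset\mathbb C$ be a positively oriented simple closed $C^1$ contour containing none of the exact nodes $\rho_1(q),\dots,\rho_r(q)$, and let $\Delta_{r,0}^{(q)},\Delta_{r,1}^{(q)}\in\mathbb C^{r\times r}$ be perturbations of the two Hankel blocks. If $$\sup_{z\in\Gamma}|\widetilde\Psi_q(z)-\Psi_q(z)|<\mu_q(\Gamma),\tag{1}$$ then $\widetilde\Psi_q$ and $\Psi_q$ have the same number of zeros in the interior of $\Gamma$, counted with multiplicity. For this it is sufficient that $$\sup_{z\in\Gamma}\left\|A_q(z)^{-1}\bigl(\Delta_{r,1}^{(q)}-z\Delta_{r,0}^{(q)}\bigr)\right\|_2<2^{1/r}-1 .\tag{2}$$ In particular, with $R_\Gamma=\max_{z\in\Gamma}|z|$, the condition $$\|\Delta_{r,1}^{(q)}\|_2+R_\Gamma\|\Delta_{r,0}^{(q)}\|_2<\bigl(2^{1/r}-1\bigr)\zeta_q(\Gamma)\tag{3}$$ is sufficient.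
   Context: Let $r\ge1$, $q\in(0,1)$, $\alpha_1,\dots,\alpha_r\in\mathbb C$, $w_1,\dots,w_r\in\mathbb C\setminus\{0\}$, with nodes $\rho_\ell(q)=q^{\alpha_\ell}=e^{\alpha_\ell\log q}$ assumed pairwise distinct. Put $\mu_n^{(q)}=\sum_{\ell=1}^r w_\ell\rho_\ell(q)^n$ for $n\ge0$ and $H_{r,s}^{(q)}=(\mu_{i+j+s}^{(q)})_{i,j=0}^{r-1}$ for $s=0,1$. The exact pencil and its characteristic are $A_q(z)=H_{r,1}^{(q)}-zH_{r,0}^{(q)}$ and $\Psi_q(z)=\det A_q(z)$. The perturbed blocks are $\widetilde H_{r,s}^{(q)}=H_{r,s}^{(q)}+\Delta_{r,s}^{(q)}$, $s=0,1$, with $\widetilde A_q(z)=\widetilde H_{r,1}^{(q)}-z\widetilde H_{r,0}^{(q)}$ and $\widetilde\Psi_q(z)=\det\widetilde A_q(z)$. The contour margins are $\mu_q(\Gamma)=\min_{z\in\Gamma}|\Psi_q(z)|$ and $\zeta_q(\Gamma)=\min_{z\in\Gamma}\sigma_{\min}(A_q(z))$, where $\sigma_{\min}$ is the smallest singular value; $\|\cdot\|_2$ is the spectral norm. *)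

theory Defs
  imports
    "HOL-Complex_Analysis.Complex_Analysis"
    "Jordan_Normal_Form.Spectral_Radius"
    "Jordan_Normal_Form.Schur_Decomposition"
    "Jordan_Normal_Form.Gauss_Jordan_Elimination"
begin

(* For 0 < q, the complex powr below is exp (a * ln q), with the real logarithm of q. *)
definition node :: "real \<Rightarrow> (nat \<Rightarrow> complex) \<Rightarrow> nat \<Rightarrow> complex" where
  "node q \<alpha> l = complex_of_real q powr \<alpha> l"

definition moment :: "nat \<Rightarrow> real \<Rightarrow> (nat \<Rightarrow> complex) \<Rightarrow> (nat \<Rightarrow> complex) \<Rightarrow> nat \<Rightarrow> complex" where
  "moment r q \<alpha> w n = (\<Sum>l=1..r. w l * node q \<alpha> l ^ n)"

definition hankel_block ::
  "nat \<Rightarrow> real \<Rightarrow> (nat \<Rightarrow> complex) \<Rightarrow> (nat \<Rightarrow> complex) \<Rightarrow> nat \<Rightarrow> complex mat" where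
  "hankel_block r q \<alpha> w s = Matrix.mat r r (\<lambda>(i, j). moment r q \<alpha> w (i + j + s))"

definition pencil :: "complex mat \<Rightarrow> complex mat \<Rightarrow> complex \<Rightarrow> complex mat" where
  "pencil H0 H1 z = H1 - z \<cdot>\<^sub>m H0"

definition pencil_char :: "complex mat \<Rightarrow> complex mat \<Rightarrow> complex \<Rightarrow> complex" where
  "pencil_char H0 H1 z = Determinant.det (pencil H0 H1 z)"

definition euclid_norm :: "complex Matrix.vec \<Rightarrow> real" where
  "euclid_norm v = L2_set (\<lambda>i. cmod (vec_index v i)) {..<dim_vec v}"

definition spectral_norm :: "complex mat \<Rightarrow> real" where
  "spectral_norm A =
     Sup {euclid_norm (A *\<^sub>v v) | v. v \<in> carrier_vec (dim_col A) \<and> euclid_norm v \<le> 1}"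

definition singular_values :: "complex mat \<Rightarrow> real set" where
  "singular_values A = {s. 0 \<le> s \<and> eigenvalue (mat_adjoint A * A) (complex_of_real (s\<^sup>2))}"

(* The minimum is over a finite set, which is nonempty for a square matrix of positive size. *)
definition sigma_min :: "complex mat \<Rightarrow> real" where
  "sigma_min A = Min (singular_values A)"

(* The library returns an option; the value is unspecified for a singular matrix. *)
definition inverse_matrix :: "complex mat \<Rightarrow> complex mat" where
  "inverse_matrix A = the (mat_inverse A)"

(* No regularity (nonvanishing derivative) and no matching of the derivatives at the two
   ends is required, so every usual reading of a simple closed C1 contour is covered.
   C1_differentiable_on uses two-sided derivatives at the end points; a map that is C1 on
   {0..1} with one-sided derivatives becomes such a map by affine extension. *)
definition pos_simple_closed_C1 :: "(real \<Rightarrow> complex) \<Rightarrow> bool" where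
  "pos_simple_closed_C1 \<gamma> \<longleftrightarrow>
     \<gamma> C1_differentiable_on {0..1} \<and> simple_path \<gamma> \<and> pathfinish \<gamma> = pathstart \<gamma> \<and>
     (\<forall>z\<in>inside (path_image \<gamma>). winding_number \<gamma> z = 1)"

(* The minima and the maximum below are those of continuous functions on the compact set
   path_image \<gamma>, hence attained and equal to the infima and the supremum. *)
definition contour_margin :: "(complex \<Rightarrow> complex) \<Rightarrow> (real \<Rightarrow> complex) \<Rightarrow> real" where
  "contour_margin \<Psi> \<gamma> = (INF z\<in>path_image \<gamma>. cmod (\<Psi> z))"

definition sigma_margin :: "(complex \<Rightarrow> complex mat) \<Rightarrow> (real \<Rightarrow> complex) \<Rightarrow> real" where
  "sigma_margin A \<gamma> = (INF z\<in>path_image \<gamma>. sigma_min (A z))"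

definition contour_radius :: "(real \<Rightarrow> complex) \<Rightarrow> real" where
  "contour_radius \<gamma> = (SUP z\<in>path_image \<gamma>. cmod z)"

(* Finiteness is included because a sum over an infinite set is 0 by convention. *)
definition same_zero_count :: "(complex \<Rightarrow> complex) \<Rightarrow> (complex \<Rightarrow> complex) \<Rightarrow> complex set \<Rightarrow> bool" where
  "same_zero_count f g S \<longleftrightarrow>
     finite {z\<in>S. f z = 0} \<and> finite {z\<in>S. g z = 0} \<and>
     (\<Sum>z | z \<in> S \<and> f z = 0. zorder f z) = (\<Sum>z | z \<in> S \<and> g z = 0. zorder g z)"

end

theory Submission
  imports Defs
begin

text \<open>
  All three criteria reduce to one pointwise inequality on the contour,
  $|\widetilde\Psi(z) - \Psi(z)| < |\Psi(z)|$, and then to Rouche's theorem: both characteristics are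
  polynomials in $z$, and the winding number of the contour is $1$ inside and $0$ outside, so the
  winding-weighted zero counts in that theorem are the plain counts inside
  (\<open>same_zero_count_polys\<close>). The condition on the margin of $\Psi$ is this inequality made
  uniform in $z$.

  For the condition on the relative perturbation, write the perturbed pencil as $A(z)(I + E)$ with
  $E = A(z)^{-1} B(z)$, where $B(z)$ is the pencil of the perturbations. The relative change of the determinant is then $\det(I + E) - 1$.
  Every eigenvalue of $E$ is at most $\|E\|$ in modulus, so expanding the product of the factors
  $1 + \lambda$ over the eigenvalues $\lambda$ bounds this change by $(1 + \|E\|)^r - 1$,
  which is below $1$ as soon as $\|E\| < 2^{1/r} - 1$ (\<open>det_perturbation_less\<close>). This requires that $A(z)$
  is invertible on the contour. A kernel vector of $A(z)$ is a polynomial $p$ of degree below $r$ for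
  which the weights $w_l (\rho_l - z) p(\rho_l)$ at the $r$ distinct nodes annihilate every monomial of
  degree below $r$; all these weights vanish by Lagrange interpolation, so $p$ has $r$ roots and is zero
  (\<open>hankel_pencil_char_nonzero\<close>).

  The condition on the smallest singular value is stronger than the previous one, pointwise on the
  contour, because $\|A^{-1} B\| \le \|B\| / \sigma_{\min}(A)$.
  This rests on the variational bound $\sigma_{\min}(A) \|v\| \le \|A v\|$. It is obtained without
  diagonalising: the infimum of $\|A v\|^2$ over unit vectors is shown to be an eigenvalue of $A^* A$
  (\<open>least_singular_value\<close>).

  Suprema of real functions are meaningful only for functions that are bounded. For the
  relative perturbation the bound comes from continuity of the adjugate, which expresses the inverse
  by determinants (\<open>bdd_above_spectral_norm_inverse_mult\<close>).
\<close>

unbundle no vec_syntax and no fps_syntax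

section \<open>The Euclidean and the spectral norm\<close>

lemma euclid_norm_nonneg [simp]: "0 \<le> euclid_norm v"
  by (simp add: euclid_norm_def L2_set_nonneg)

lemma euclid_norm_add:
  assumes "u \<in> carrier_vec n" "v \<in> carrier_vec n"
  shows "euclid_norm (u + v) \<le> euclid_norm u + euclid_norm v"
proof -
  have "euclid_norm (u + v) = L2_set (\<lambda>i. cmod (u $ i + v $ i)) {..<n}"
    unfolding euclid_norm_def using assms by (intro L2_set_cong) auto
  also have "\<dots> \<le> L2_set (\<lambda>i. cmod (u $ i) + cmod (v $ i)) {..<n}"
    by (intro L2_set_mono norm_triangle_ineq) auto
  also have "\<dots> \<le> euclid_norm u + euclid_norm v"
    unfolding euclid_norm_def using assms L2_set_triangle_ineq by fastforce
  finally show ?thesis .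
qed

lemma euclid_norm_smult: "euclid_norm (c \<cdot>\<^sub>v v) = cmod c * euclid_norm v"
proof -
  have "euclid_norm (c \<cdot>\<^sub>v v) = L2_set (\<lambda>i. cmod c * cmod (v $ i)) {..<dim_vec v}"
    unfolding euclid_norm_def by (intro L2_set_cong) (auto simp: norm_mult)
  then show ?thesis
    by (simp add: euclid_norm_def L2_set_right_distrib)
qed

lemma euclid_norm_zero [simp]: "euclid_norm (0\<^sub>v n) = 0"
  unfolding euclid_norm_def by (subst L2_set_eq_0_iff) auto

lemma euclid_norm_eq_0_iff:
  "v \<in> carrier_vec n \<Longrightarrow> euclid_norm v = 0 \<longleftrightarrow> v = 0\<^sub>v n"
  unfolding euclid_norm_def by (subst L2_set_eq_0_iff) auto

text \<open>
  A crude bound, but one in terms of the entries. It makes the supremum that defines the spectral norm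
  finite, and it allows that norm to be controlled by continuous functions of the entries.
\<close>

lemma euclid_norm_mult_le_entries:
  assumes v: "v \<in> carrier_vec (dim_col A)"
  shows "euclid_norm (A *\<^sub>v v)
           \<le> (\<Sum>i<dim_row A. \<Sum>j<dim_col A. cmod (A $$ (i, j))) * euclid_norm v"
proof -
  have entry: "cmod ((A *\<^sub>v v) $ i) \<le> (\<Sum>j<dim_col A. cmod (A $$ (i, j))) * euclid_norm v"
    if i: "i < dim_row A" for i
  proof -
    have "cmod ((A *\<^sub>v v) $ i) = cmod (\<Sum>j<dim_col A. A $$ (i, j) * v $ j)"
      using i v by (simp add: scalar_prod_def lessThan_atLeast0)
    also have "\<dots> \<le> (\<Sum>j<dim_col A. cmod (A $$ (i, j)) * cmod (v $ j))"
      by (rule order_trans[OF norm_sum]) (simp add: norm_mult)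
    also have "\<dots> \<le> (\<Sum>j<dim_col A. cmod (A $$ (i, j)) * euclid_norm v)"
      using v unfolding euclid_norm_def
      by (intro sum_mono mult_left_mono member_le_L2_set) auto
    finally show ?thesis by (simp add: sum_distrib_right)
  qed
  have "euclid_norm (A *\<^sub>v v) \<le> (\<Sum>i<dim_row A. cmod ((A *\<^sub>v v) $ i))"
    unfolding euclid_norm_def by (rule order_trans[OF L2_set_le_sum]) auto
  also have "\<dots> \<le> (\<Sum>i<dim_row A. (\<Sum>j<dim_col A. cmod (A $$ (i, j))) * euclid_norm v)"
    by (intro sum_mono entry) auto
  finally show ?thesis by (simp add: sum_distrib_right)
qed

lemma spectral_norm_least:
  assumes bound: "\<And>v. v \<in> carrier_vec (dim_col A) \<Longrightarrow> euclid_norm (A *\<^sub>v v) \<le> c * euclid_norm v"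
    and c: "0 \<le> c"
  shows "spectral_norm A \<le> c"
  unfolding spectral_norm_def
proof (rule cSup_least)
  show "{euclid_norm (A *\<^sub>v v) |v. v \<in> carrier_vec (dim_col A) \<and> euclid_norm v \<le> 1} \<noteq> {}"
    by (auto intro!: exI[of _ "0\<^sub>v (dim_col A)"])
next
  fix x assume "x \<in> {euclid_norm (A *\<^sub>v v) |v. v \<in> carrier_vec (dim_col A) \<and> euclid_norm v \<le> 1}"
  then obtain v where v: "v \<in> carrier_vec (dim_col A)" "euclid_norm v \<le> 1"
    and x: "x = euclid_norm (A *\<^sub>v v)" by auto
  have "x \<le> c * euclid_norm v" using bound v x by auto
  also have "\<dots> \<le> c" using v(2) c by (simp add: mult_left_le)
  finally show "x \<le> c" .
qed

lemma spectral_norm_le_entries: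
  "spectral_norm A \<le> (\<Sum>i<dim_row A. \<Sum>j<dim_col A. cmod (A $$ (i, j)))"
  by (intro spectral_norm_least euclid_norm_mult_le_entries sum_nonneg) auto

lemma euclid_norm_le_spectral_norm_unit:
  assumes "v \<in> carrier_vec (dim_col A)" "euclid_norm v \<le> 1"
  shows "euclid_norm (A *\<^sub>v v) \<le> spectral_norm A"
  unfolding spectral_norm_def
proof (rule cSup_upper)
  show "euclid_norm (A *\<^sub>v v)
      \<in> {euclid_norm (A *\<^sub>v v) |v. v \<in> carrier_vec (dim_col A) \<and> euclid_norm v \<le> 1}"
    using assms by auto
  let ?C = "\<Sum>i<dim_row A. \<Sum>j<dim_col A. cmod (A $$ (i, j))"
  have C: "0 \<le> ?C" by (intro sum_nonneg) auto
  show "bdd_above {euclid_norm (A *\<^sub>v v) |v. v \<in> carrier_vec (dim_col A) \<and> euclid_norm v \<le> 1}"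
  proof (rule bdd_aboveI[of _ ?C])
    fix x assume "x \<in> {euclid_norm (A *\<^sub>v v) |v. v \<in> carrier_vec (dim_col A) \<and> euclid_norm v \<le> 1}"
    then obtain v where v: "v \<in> carrier_vec (dim_col A)" "euclid_norm v \<le> 1"
      and x: "x = euclid_norm (A *\<^sub>v v)" by auto
    have "x \<le> ?C * euclid_norm v" using euclid_norm_mult_le_entries v x by auto
    also have "\<dots> \<le> ?C" using v(2) C by (simp add: mult_left_le)
    finally show "x \<le> ?C" .
  qed
qed

lemma spectral_norm_nonneg: "0 \<le> spectral_norm A"
  using euclid_norm_le_spectral_norm_unit[of "0\<^sub>v (dim_col A)" A] order_trans[OF euclid_norm_nonneg]
  by auto

text \<open>
  Homogeneity extends the bound from the unit ball to all vectors. The zero vector cannot be normalised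
  and is covered by the bound in terms of the entries.
\<close>

lemma euclid_norm_mult_le_spectral_norm:
  assumes v: "v \<in> carrier_vec (dim_col A)"
  shows "euclid_norm (A *\<^sub>v v) \<le> spectral_norm A * euclid_norm v"
proof (cases "euclid_norm v = 0")
  case True
  then show ?thesis using euclid_norm_mult_le_entries[OF v] by simp
next
  case False
  let ?t = "euclid_norm v" and ?u = "complex_of_real (1 / euclid_norm v) \<cdot>\<^sub>v v"
  have pos: "0 < ?t" using False euclid_norm_nonneg[of v] by linarith
  have "euclid_norm (A *\<^sub>v ?u) \<le> spectral_norm A"
    using v pos by (intro euclid_norm_le_spectral_norm_unit) (auto simp: euclid_norm_smult norm_divide)
  moreover have "A *\<^sub>v ?u = complex_of_real (1 / ?t) \<cdot>\<^sub>v (A *\<^sub>v v)"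
    by (rule mult_mat_vec[of _ "dim_row A" "dim_col A"]) (use v in auto)
  ultimately have "euclid_norm (A *\<^sub>v v) / ?t \<le> spectral_norm A"
    using pos by (simp add: euclid_norm_smult norm_divide)
  then show ?thesis using pos by (simp add: field_simps)
qed

section \<open>Determinants of perturbations of the identity\<close>

text \<open>
  In the expansion of the product, a choice of $k$ elements contributes at most $c^k$ in modulus, and the
  empty choice is the $1$ that is subtracted. The induction peels off one factor at a time.
\<close>

lemma prod_list_one_minus_bound:
  fixes as :: "complex list"
  assumes "\<And>a. a \<in> set as \<Longrightarrow> cmod a \<le> c" "0 \<le> c"
  shows "cmod ((\<Prod>a\<leftarrow>as. 1 - a) - 1) \<le> (1 + c) ^ length as - 1"
  using assms(1)
proof (induction as)
  case Nil
  then show ?case by simp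
next
  case (Cons a as)
  let ?P = "\<Prod>a\<leftarrow>as. 1 - a"
  have IH: "cmod (?P - 1) \<le> (1 + c) ^ length as - 1" and a: "cmod a \<le> c"
    using Cons by auto
  have "(1 - a) * ?P - 1 = (1 - a) * (?P - 1) - a" by (simp add: algebra_simps)
  then have "cmod ((1 - a) * ?P - 1) \<le> cmod (1 - a) * cmod (?P - 1) + cmod a"
    by (metis norm_mult norm_triangle_ineq4)
  also have "\<dots> \<le> (1 + c) * ((1 + c) ^ length as - 1) + c"
    using a norm_triangle_ineq4[of 1 a] IH \<open>0 \<le> c\<close>
    by (intro add_mono mult_mono) auto
  finally show ?case by (simp add: algebra_simps)
qed

lemma eigenvalue_le_spectral_norm:
  assumes E: "E \<in> carrier_mat n n" and ev: "eigenvalue E a"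
  shows "cmod a \<le> spectral_norm E"
proof -
  from ev E obtain v where v: "v \<in> carrier_vec n" "v \<noteq> 0\<^sub>v n" "E *\<^sub>v v = a \<cdot>\<^sub>v v"
    unfolding eigenvalue_def eigenvector_def by auto
  have "cmod a * euclid_norm v \<le> spectral_norm E * euclid_norm v"
    using euclid_norm_mult_le_spectral_norm[of v E] v E by (simp add: euclid_norm_smult)
  moreover have "0 < euclid_norm v"
    using v euclid_norm_eq_0_iff[OF v(1)] euclid_norm_nonneg[of v] by linarith
  ultimately show ?thesis by simp
qed

text \<open>
  The determinant of $I - E$ is the characteristic polynomial of $E$ at $1$, hence the product of
  $1 - a$ over the eigenvalues $a$ of $E$ with multiplicity.
\<close>

lemma det_one_minus_bound:
  assumes E: "E \<in> carrier_mat n n"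
  shows "cmod (Determinant.det (1\<^sub>m n - E) - 1) \<le> (1 + spectral_norm E) ^ n - 1"
proof -
  obtain as where as: "char_poly E = (\<Prod>a\<leftarrow>as. [:- a, 1:])" "length as = n"
    using char_poly_factorized[OF E] by auto
  have "poly (char_poly E) 1 = Determinant.det (1\<^sub>m n - E)"
    unfolding char_poly_def
    by (rule poly_det_cong[of _ n]) (use E in \<open>auto simp: char_poly_matrix_def\<close>)
  moreover have "poly (char_poly E) 1 = (\<Prod>a\<leftarrow>as. 1 - a)"
    unfolding as(1) by (simp add: poly_prod_list o_def)
  moreover have "cmod a \<le> spectral_norm E" if "a \<in> set as" for a
    using that as(1) linear_poly_root[OF that] eigenvalue_root_char_poly[OF E, of a]
    by (intro eigenvalue_le_spectral_norm[OF E]) simp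
  ultimately show ?thesis
    using prod_list_one_minus_bound[of as "spectral_norm E"] as(2) spectral_norm_nonneg by simp
qed

lemma spectral_norm_uminus: "spectral_norm (- A) = spectral_norm A"
proof -
  have *: "euclid_norm (- A *\<^sub>v v) = euclid_norm (A *\<^sub>v v)" if "v \<in> carrier_vec (dim_col A)" for v
  proof -
    have "- A *\<^sub>v v = (-1) \<cdot>\<^sub>v (A *\<^sub>v v)" using that by auto
    then show ?thesis by (simp add: euclid_norm_smult)
  qed
  have "{euclid_norm (- A *\<^sub>v v) |v. v \<in> carrier_vec (dim_col A) \<and> euclid_norm v \<le> 1}
      = {euclid_norm (A *\<^sub>v v) |v. v \<in> carrier_vec (dim_col A) \<and> euclid_norm v \<le> 1}"
    using * by metis
  then show ?thesis unfolding spectral_norm_def by simp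
qed

section \<open>Relative perturbations\<close>

text \<open>
  The adjugate formula puts the matrix into the unit group, so that Gauss-Jordan elimination succeeds;
  it is also what makes the inverse visibly continuous in the entries.
\<close>

lemma inverse_matrix_eq:
  assumes A: "A \<in> carrier_mat n n" and det: "Determinant.det A \<noteq> 0"
  shows "inverse_matrix A \<in> carrier_mat n n"
    and "A * inverse_matrix A = 1\<^sub>m n"
    and "inverse_matrix A * A = 1\<^sub>m n"
    and "inverse_matrix A = (1 / Determinant.det A) \<cdot>\<^sub>m adj_mat A"
proof -
  let ?C = "(1 / Determinant.det A) \<cdot>\<^sub>m adj_mat A"
  note adj = adj_mat[OF A]
  have C: "?C \<in> carrier_mat n n" using adj(1) by simp
  have AC: "A * ?C = 1\<^sub>m n"
    using mult_smult_distrib[OF A adj(1)] adj(2) det by (auto intro!: eq_matI)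
  have CA: "?C * A = 1\<^sub>m n"
    using mult_smult_assoc_mat[OF adj(1) A] adj(3) det by (auto intro!: eq_matI)
  have "A \<in> Units (ring_mat TYPE(complex) n ())"
    using A C AC CA unfolding Units_def by (auto simp: ring_mat_simps)
  then obtain B where B: "mat_inverse A = Some B"
    using mat_inverse(1)[OF A, of "()"] by blast
  then have inv: "inverse_matrix A = B" by (simp add: inverse_matrix_def)
  show 1: "inverse_matrix A \<in> carrier_mat n n" and "A * inverse_matrix A = 1\<^sub>m n"
    and 2: "inverse_matrix A * A = 1\<^sub>m n"
    using mat_inverse(2)[OF A B] inv by auto
  have "inverse_matrix A = inverse_matrix A * (A * ?C)" using 1 AC by simp
  also have "\<dots> = (inverse_matrix A * A) * ?C" using 1 A C by (metis assoc_mult_mat)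
  also have "\<dots> = ?C" unfolding 2 using C by (rule left_mult_one_mat)
  finally show "inverse_matrix A = ?C" .
qed

text \<open>
  Factor $A + B = A (I + A^{-1} B)$. The threshold is the value at which $(1 + x)^n - 1$ reaches $1$.
\<close>

lemma det_perturbation_less:
  assumes A: "A \<in> carrier_mat n n" and B: "B \<in> carrier_mat n n" and n: "1 \<le> n"
    and det: "Determinant.det A \<noteq> 0"
    and small: "spectral_norm (inverse_matrix A * B) < 2 powr (1 / real n) - 1"
  shows "cmod (Determinant.det (A + B) - Determinant.det A) < cmod (Determinant.det A)"
proof -
  note inv = inverse_matrix_eq[OF A det]
  let ?E = "inverse_matrix A * B"
  have E: "?E \<in> carrier_mat n n" using inv(1) B by simp
  have "A * (1\<^sub>m n + ?E) = A + A * ?E"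
    using A E by (simp add: mult_add_distrib_mat[OF A one_carrier_mat E])
  also have "A * ?E = B"
    using assoc_mult_mat[OF A inv(1) B] inv(2) B by simp
  finally have "Determinant.det (A + B) = Determinant.det A * Determinant.det (1\<^sub>m n + ?E)"
    using det_mult[OF A, of "1\<^sub>m n + ?E"] E by simp
  then have eq: "cmod (Determinant.det (A + B) - Determinant.det A)
      = cmod (Determinant.det A) * cmod (Determinant.det (1\<^sub>m n + ?E) - 1)"
    by (metis mult.right_neutral norm_mult right_diff_distrib)
  have "1\<^sub>m n - (- ?E) = 1\<^sub>m n + ?E" using E by (intro eq_matI) auto
  then have "cmod (Determinant.det (1\<^sub>m n + ?E) - 1) \<le> (1 + spectral_norm ?E) ^ n - 1"
    using det_one_minus_bound[of "- ?E" n] E by (simp add: spectral_norm_uminus)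
  also have "(1 + spectral_norm ?E) ^ n < (2 powr (1 / real n)) ^ n"
    using small n spectral_norm_nonneg[of ?E] by (intro power_strict_mono) auto
  also have "(2 powr (1 / real n)) ^ n = (2 :: real)"
    using n by (simp add: powr_power)
  finally show ?thesis using det eq by simp
qed

section \<open>The smallest singular value\<close>

lemma mat_adjoint_carrier: "A \<in> carrier_mat m n \<Longrightarrow> mat_adjoint A \<in> carrier_mat n m"
  unfolding mat_adjoint_def carrier_mat_def by auto

lemma mat_adjoint_index:
  "A \<in> carrier_mat m n \<Longrightarrow> i < m \<Longrightarrow> j < n \<Longrightarrow> mat_adjoint A $$ (j, i) = cnj (A $$ (i, j))"
  unfolding mat_adjoint_def by (auto simp: mat_of_rows_index)

lemma cscalar_prod_mult_adjoint:
  fixes A :: "complex mat"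
  assumes A: "A \<in> carrier_mat m n" and u: "u \<in> carrier_vec n" and w: "w \<in> carrier_vec m"
  shows "(A *\<^sub>v u) \<bullet>c w = u \<bullet>c (mat_adjoint A *\<^sub>v w)"
proof -
  have "(A *\<^sub>v u) \<bullet>c w = (\<Sum>i<m. (\<Sum>j<n. A $$ (i, j) * u $ j) * cnj (w $ i))"
    using A u w by (auto simp: scalar_prod_def lessThan_atLeast0 intro!: sum.cong)
  also have "\<dots> = (\<Sum>j<n. u $ j * (\<Sum>i<m. A $$ (i, j) * cnj (w $ i)))"
    unfolding sum_distrib_left sum_distrib_right
    by (subst sum.swap) (auto intro!: sum.cong)
  also have "\<dots> = (\<Sum>j<n. u $ j * cnj (\<Sum>i<m. mat_adjoint A $$ (j, i) * w $ i))"
    by (auto simp: mat_adjoint_index[OF A] intro!: sum.cong)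
  also have "\<dots> = u \<bullet>c (mat_adjoint A *\<^sub>v w)"
    using mat_adjoint_carrier[OF A] u w
    by (auto simp: scalar_prod_def lessThan_atLeast0 intro!: sum.cong)
  finally show ?thesis .
qed

lemma euclid_norm_power2: "(euclid_norm v)\<^sup>2 = (\<Sum>i<dim_vec v. (cmod (v $ i))\<^sup>2)"
  unfolding euclid_norm_def L2_set_def by (simp add: sum_nonneg)

lemma Re_cscalar_prod_eq_sum:
  fixes u v :: "complex Matrix.vec"
  assumes "u \<in> carrier_vec n" "v \<in> carrier_vec n"
  shows "Re (u \<bullet>c v) = (\<Sum>i<n. Re (u $ i * cnj (v $ i)))"
  using assms by (auto simp: scalar_prod_def lessThan_atLeast0 intro!: sum.cong)

lemma Re_cscalar_prod_self:
  assumes "v \<in> carrier_vec n"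
  shows "Re (v \<bullet>c v) = (euclid_norm v)\<^sup>2"
  unfolding Re_cscalar_prod_eq_sum[OF assms assms] euclid_norm_power2
  by (intro sum.cong) (use assms in \<open>auto simp: cmod_power2 simp flip: power2_eq_square\<close>)

lemma Re_cscalar_prod_commute:
  fixes u v :: "complex Matrix.vec"
  assumes "u \<in> carrier_vec n" "v \<in> carrier_vec n"
  shows "Re (u \<bullet>c v) = Re (v \<bullet>c u)"
  unfolding Re_cscalar_prod_eq_sum[OF assms] Re_cscalar_prod_eq_sum[OF assms(2,1)]
  by (intro sum.cong) auto

lemma euclid_norm_minus_power2:
  assumes u: "u \<in> carrier_vec n" and v: "v \<in> carrier_vec n"
  shows "(euclid_norm (u - complex_of_real t \<cdot>\<^sub>v v))\<^sup>2
           = (euclid_norm u)\<^sup>2 - 2 * t * Re (u \<bullet>c v) + t\<^sup>2 * (euclid_norm v)\<^sup>2"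
proof -
  have pointwise: "(cmod (x - complex_of_real t * y))\<^sup>2
      = (cmod x)\<^sup>2 - 2 * t * Re (x * cnj y) + t\<^sup>2 * (cmod y)\<^sup>2" for x y
    unfolding cmod_power2 by (simp add: power2_eq_square algebra_simps)
  have "(euclid_norm (u - complex_of_real t \<cdot>\<^sub>v v))\<^sup>2
      = (\<Sum>i<n. (cmod (u $ i))\<^sup>2 - 2 * t * Re (u $ i * cnj (v $ i)) + t\<^sup>2 * (cmod (v $ i))\<^sup>2)"
    unfolding euclid_norm_power2 pointwise[symmetric] using u v by (intro sum.cong) auto
  also have "\<dots> = (\<Sum>i<n. (cmod (u $ i))\<^sup>2) - 2 * t * (\<Sum>i<n. Re (u $ i * cnj (v $ i)))
      + t\<^sup>2 * (\<Sum>i<n. (cmod (v $ i))\<^sup>2)"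
    unfolding sum.distrib sum_subtractf sum_distrib_left ..
  finally show ?thesis
    using u v unfolding euclid_norm_power2 Re_cscalar_prod_eq_sum[OF u v] by simp
qed

text \<open>
  Let $\mu$ be the infimum of $\|A v\|^2$ over unit vectors, so that
  $Q(v) = \|A v\|^2 - \mu \|v\|^2 = \langle P v, v \rangle$ with $P = A^* A - \mu I$ is a positive
  semidefinite form. For such a form $\|P u\|^2$ is at most a constant times $Q(u)$. If $P$ were invertible,
  $\|P u\|$ would be bounded below on unit vectors, hence so would $Q$, and $\mu$ would not be the infimum.
  So $\mu$ is an eigenvalue of $A^* A$ and its square root is the required singular value.
\<close>

lemma least_singular_value:
  assumes A: "A \<in> carrier_mat n n" and n: "1 \<le> n"
  obtains s where "s \<in> singular_values A"
    and "\<And>v. v \<in> carrier_vec n \<Longrightarrow> s * euclid_norm v \<le> euclid_norm (A *\<^sub>v v)"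
proof -
  define S where "S = {(euclid_norm (A *\<^sub>v v))\<^sup>2 | v. v \<in> carrier_vec n \<and> euclid_norm v = 1}"
  define \<mu> where "\<mu> = Inf S"
  define Q where "Q = (\<lambda>v. (euclid_norm (A *\<^sub>v v))\<^sup>2 - \<mu> * (euclid_norm v)\<^sup>2)"
  have "euclid_norm (unit_vec n 0) = 1"
    unfolding euclid_norm_def L2_set_def
    using n by (simp add: unit_vec_def if_distrib[of cmod] if_distrib[of "\<lambda>x. x\<^sup>2"] cong: if_cong)
  then have S_ne: "S \<noteq> {}" unfolding S_def by (auto intro!: exI[of _ "unit_vec n 0"])
  have S_bdd: "bdd_below S" unfolding S_def by (rule bdd_belowI[of _ 0]) auto
  have \<mu>: "0 \<le> \<mu>" unfolding \<mu>_def using S_ne by (intro cInf_greatest) (auto simp: S_def)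
  have Q_nonneg: "0 \<le> Q v" if v: "v \<in> carrier_vec n" for v
  proof (cases "euclid_norm v = 0")
    case True
    then show ?thesis by (simp add: Q_def)
  next
    case False
    then have pos: "0 < euclid_norm v" using euclid_norm_nonneg[of v] by linarith
    let ?c = "complex_of_real (1 / euclid_norm v)"
    have "euclid_norm (?c \<cdot>\<^sub>v v) = 1" using pos by (simp add: euclid_norm_smult norm_divide)
    then have "(euclid_norm (A *\<^sub>v (?c \<cdot>\<^sub>v v)))\<^sup>2 \<in> S" using v by (auto simp: S_def)
    then have "\<mu> \<le> (euclid_norm (A *\<^sub>v (?c \<cdot>\<^sub>v v)))\<^sup>2"
      unfolding \<mu>_def using S_bdd by (rule cInf_lower)
    also have "\<dots> = (euclid_norm (A *\<^sub>v v))\<^sup>2 / (euclid_norm v)\<^sup>2"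
      by (simp add: mult_mat_vec[OF A v] euclid_norm_smult norm_divide power_divide)
    finally show ?thesis using pos by (simp add: Q_def field_simps)
  qed
  define M where "M = mat_adjoint A * A"
  have M: "M \<in> carrier_mat n n" unfolding M_def using mat_adjoint_carrier[OF A] A by auto
  have Mv: "M *\<^sub>v v = mat_adjoint A *\<^sub>v (A *\<^sub>v v)" if "v \<in> carrier_vec n" for v
    unfolding M_def using mat_adjoint_carrier[OF A] A that by (rule assoc_mult_mat_vec)
  have "eigenvalue M (complex_of_real \<mu>)"
  proof (rule ccontr)
    define P where "P = char_matrix M (complex_of_real \<mu>)"
    assume "\<not> eigenvalue M (complex_of_real \<mu>)"
    then have det: "Determinant.det P \<noteq> 0" using eigenvalue_det[OF M] by (simp add: P_def)
    have P: "P \<in> carrier_mat n n" unfolding P_def using M by simp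
    have Pv: "P *\<^sub>v v = M *\<^sub>v v - complex_of_real \<mu> \<cdot>\<^sub>v v" if v: "v \<in> carrier_vec n" for v
    proof -
      have "P *\<^sub>v v = M *\<^sub>v v + ((- complex_of_real \<mu>) \<cdot>\<^sub>m 1\<^sub>m n) *\<^sub>v v"
        unfolding P_def char_matrix_def using M v
        by (simp add: add_mult_distrib_mat_vec[of _ n n])
      also have "((- complex_of_real \<mu>) \<cdot>\<^sub>m 1\<^sub>m n) *\<^sub>v v = (- complex_of_real \<mu>) \<cdot>\<^sub>v v"
        using v by (intro eq_vecI) auto
      finally show ?thesis using M v by (intro eq_vecI) auto
    qed
    define C where "C = spectral_norm (inverse_matrix P)"
    \<comment> \<open>The summand 1 keeps the constant positive when \<open>A\<close> is zero.\<close>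
    define K where "K = (spectral_norm A)\<^sup>2 + 1"
    note inv = inverse_matrix_eq[OF P det]
    have K: "0 < K" unfolding K_def by (simp add: add_nonneg_pos)
    have lower: "1 \<le> C\<^sup>2 * K * Q u" if u: "u \<in> carrier_vec n" and u1: "euclid_norm u = 1" for u
    proof -
      \<comment> \<open>Moving from \<open>u\<close> against the gradient \<open>g\<close> of the form with step \<open>t\<close> must keep \<open>Q\<close> nonnegative.\<close>
      define g where "g = P *\<^sub>v u"
      \<comment> \<open>This step maximises the guaranteed decrease, as \<open>Q g\<close> is at most \<open>K\<close> times the squared norm of \<open>g\<close>.\<close>
      define t where "t = 1 / K"
      have g: "g \<in> carrier_vec n" using P u by (simp add: g_def)
      have Au: "A *\<^sub>v u \<in> carrier_vec n" and Ag: "A *\<^sub>v g \<in> carrier_vec n"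
        and Mu: "M *\<^sub>v u \<in> carrier_vec n"
        using A M u g by auto
      have "Re ((A *\<^sub>v u) \<bullet>c (A *\<^sub>v g)) = Re (g \<bullet>c (M *\<^sub>v u))"
        unfolding Mv[OF u] cscalar_prod_mult_adjoint[OF A g Au, symmetric]
        by (rule Re_cscalar_prod_commute[OF Au Ag])
      moreover have "Re (g \<bullet>c (M *\<^sub>v u)) - \<mu> * Re (g \<bullet>c u) = Re (g \<bullet>c g)"
        unfolding Re_cscalar_prod_eq_sum[OF g Mu] Re_cscalar_prod_eq_sum[OF g u]
          Re_cscalar_prod_eq_sum[OF g g] sum_distrib_left sum_subtractf[symmetric]
        using Mu u by (intro sum.cong) (auto simp: g_def Pv[OF u] algebra_simps)
      ultimately have cross: "Re ((A *\<^sub>v u) \<bullet>c (A *\<^sub>v g)) - \<mu> * Re (u \<bullet>c g) = (euclid_norm g)\<^sup>2"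
        using Re_cscalar_prod_commute[OF u g] Re_cscalar_prod_self[OF g] by simp
      have "A *\<^sub>v (u - complex_of_real t \<cdot>\<^sub>v g) = A *\<^sub>v u - complex_of_real t \<cdot>\<^sub>v (A *\<^sub>v g)"
        using A u g by (simp add: mult_minus_distrib_mat_vec[of _ n n] mult_mat_vec[of _ n n])
      then have "Q (u - complex_of_real t \<cdot>\<^sub>v g)
          = Q u - 2 * t * (Re ((A *\<^sub>v u) \<bullet>c (A *\<^sub>v g)) - \<mu> * Re (u \<bullet>c g)) + t\<^sup>2 * Q g"
        unfolding Q_def
        by (simp add: euclid_norm_minus_power2[OF u g] euclid_norm_minus_power2[OF Au Ag] algebra_simps)
      then have "0 \<le> Q u - 2 * t * (euclid_norm g)\<^sup>2 + t\<^sup>2 * Q g"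
        using Q_nonneg[of "u - complex_of_real t \<cdot>\<^sub>v g"] u g cross by simp
      moreover have "Q g \<le> K * (euclid_norm g)\<^sup>2"
      proof -
        have "(euclid_norm (A *\<^sub>v g))\<^sup>2 \<le> (spectral_norm A * euclid_norm g)\<^sup>2"
          using euclid_norm_mult_le_spectral_norm[of g A] A g by (intro power_mono) auto
        moreover have "0 \<le> \<mu> * (euclid_norm g)\<^sup>2" using \<mu> by simp
        moreover have "0 \<le> (euclid_norm g)\<^sup>2" by simp
        ultimately show ?thesis
          unfolding Q_def K_def power_mult_distrib distrib_right mult_1 by linarith
      qed
      then have "t\<^sup>2 * Q g \<le> t\<^sup>2 * (K * (euclid_norm g)\<^sup>2)" by (rule mult_left_mono) simp
      moreover have "Q u - 2 * t * (euclid_norm g)\<^sup>2 + t\<^sup>2 * (K * (euclid_norm g)\<^sup>2)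
          = Q u - (euclid_norm g)\<^sup>2 / K"
        using K by (simp add: t_def power2_eq_square field_simps)
      ultimately have "(euclid_norm g)\<^sup>2 / K \<le> Q u" by linarith
      then have gK: "(euclid_norm g)\<^sup>2 \<le> K * Q u" using K by (simp add: field_simps)
      have "inverse_matrix P *\<^sub>v g = u"
        unfolding g_def using assoc_mult_mat_vec[OF inv(1) P u] inv(3) u by simp
      then have "1 \<le> C * euclid_norm g"
        using euclid_norm_mult_le_spectral_norm[of g "inverse_matrix P"] inv(1) g u1
        by (simp add: C_def)
      then have "1 \<le> (C * euclid_norm g)\<^sup>2" by (rule one_le_power)
      also have "\<dots> \<le> C\<^sup>2 * (K * Q u)"
        unfolding power_mult_distrib using gK by (intro mult_left_mono) auto
      finally show ?thesis by (simp add: mult.assoc)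
    qed
    have C: "0 < C\<^sup>2 * K"
    proof -
      obtain u where u: "u \<in> carrier_vec n" "euclid_norm u = 1" using S_ne by (auto simp: S_def)
      then have "C \<noteq> 0" using lower[OF u] by auto
      then show ?thesis using K by simp
    qed
    have "\<mu> + 1 / (C\<^sup>2 * K) \<le> Inf S"
    proof (rule cInf_greatest[OF S_ne])
      fix x assume "x \<in> S"
      then obtain u where u: "u \<in> carrier_vec n" "euclid_norm u = 1"
        and x: "x = (euclid_norm (A *\<^sub>v u))\<^sup>2" by (auto simp: S_def)
      have "1 / (C\<^sup>2 * K) \<le> Q u"
        using lower[OF u] C by (simp add: divide_le_eq mult.commute)
      then show "\<mu> + 1 / (C\<^sup>2 * K) \<le> x" using x u by (simp add: Q_def)
    qed
    moreover have "0 < 1 / (C\<^sup>2 * K)" using C by simp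
    ultimately show False unfolding \<mu>_def by linarith
  qed
  then have "sqrt \<mu> \<in> singular_values A" using \<mu> by (simp add: singular_values_def M_def flip: of_real_power)
  moreover have "sqrt \<mu> * euclid_norm v \<le> euclid_norm (A *\<^sub>v v)" if "v \<in> carrier_vec n" for v
  proof (rule power2_le_imp_le)
    show "(sqrt \<mu> * euclid_norm v)\<^sup>2 \<le> (euclid_norm (A *\<^sub>v v))\<^sup>2"
      using Q_nonneg[OF that] \<mu> by (simp add: Q_def power_mult_distrib)
  qed simp
  ultimately show thesis by (rule that)
qed

text \<open>
  Squaring is injective on nonnegative numbers and maps the singular values into a finite spectrum.
  Finiteness is what makes the minimum in the definition of the smallest one meaningful.
\<close>

lemma finite_singular_values:
  assumes A: "A \<in> carrier_mat n n"
  shows "finite (singular_values A)"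
proof -
  have M: "mat_adjoint A * A \<in> carrier_mat n n" using mat_adjoint_carrier[OF A] A by auto
  have "finite ((\<lambda>s. complex_of_real (s\<^sup>2)) ` singular_values A)"
    by (rule finite_subset[OF _ card_finite_spectrum(1)[OF M]])
      (auto simp: singular_values_def spectrum_def)
  moreover have "inj_on (\<lambda>s. complex_of_real (s\<^sup>2)) (singular_values A)"
    by (rule inj_onI) (simp only: of_real_eq_iff singular_values_def mem_Collect_eq, simp)
  ultimately show ?thesis by (simp add: finite_image_iff)
qed

lemma sigma_min_mult_le:
  assumes A: "A \<in> carrier_mat n n" and n: "1 \<le> n" and v: "v \<in> carrier_vec n"
  shows "sigma_min A * euclid_norm v \<le> euclid_norm (A *\<^sub>v v)"
proof -
  obtain s where s: "s \<in> singular_values A"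
    and le: "\<And>v. v \<in> carrier_vec n \<Longrightarrow> s * euclid_norm v \<le> euclid_norm (A *\<^sub>v v)"
    using least_singular_value[OF A n] by blast
  have "sigma_min A \<le> s"
    unfolding sigma_min_def using finite_singular_values[OF A] s by simp
  then have "sigma_min A * euclid_norm v \<le> s * euclid_norm v" by (rule mult_right_mono) simp
  then show ?thesis using le[OF v] by simp
qed

lemma sigma_min_nonneg:
  assumes A: "A \<in> carrier_mat n n" and n: "1 \<le> n"
  shows "0 \<le> sigma_min A"
proof -
  obtain s where "s \<in> singular_values A"
    using least_singular_value[OF A n] by blast
  then have "sigma_min A \<in> singular_values A"
    unfolding sigma_min_def using finite_singular_values[OF A] by (intro Min_in) auto
  then show ?thesis by (simp add: singular_values_def)
qed

lemma spectral_norm_inverse_mult_le: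
  assumes A: "A \<in> carrier_mat n n" and B: "B \<in> carrier_mat n n" and n: "1 \<le> n"
    and det: "Determinant.det A \<noteq> 0"
    and pos: "0 < sigma_min A"
  shows "spectral_norm (inverse_matrix A * B) \<le> spectral_norm B / sigma_min A"
proof (rule spectral_norm_least)
  note inv = inverse_matrix_eq[OF A det]
  fix v :: "complex Matrix.vec" assume "v \<in> carrier_vec (dim_col (inverse_matrix A * B))"
  then have v: "v \<in> carrier_vec n" using B by simp
  have Bv: "B *\<^sub>v v \<in> carrier_vec n" using B v by simp
  have "inverse_matrix A * B *\<^sub>v v = inverse_matrix A *\<^sub>v (B *\<^sub>v v)"
    by (rule assoc_mult_mat_vec[OF inv(1) B v])
  moreover have "A *\<^sub>v (inverse_matrix A *\<^sub>v (B *\<^sub>v v)) = B *\<^sub>v v"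
    using assoc_mult_mat_vec[OF A inv(1) Bv] inv(2) Bv by simp
  ultimately have "sigma_min A * euclid_norm (inverse_matrix A * B *\<^sub>v v) \<le> euclid_norm (B *\<^sub>v v)"
    using sigma_min_mult_le[OF A n, of "inverse_matrix A *\<^sub>v (B *\<^sub>v v)"] inv(1) Bv by simp
  also have "\<dots> \<le> spectral_norm B * euclid_norm v"
    using euclid_norm_mult_le_spectral_norm[of v B] B v by simp
  finally show "euclid_norm (inverse_matrix A * B *\<^sub>v v) \<le> spectral_norm B / sigma_min A * euclid_norm v"
    using pos by (simp add: field_simps)
next
  show "0 \<le> spectral_norm B / sigma_min A" using pos spectral_norm_nonneg[of B] by simp
qed

section \<open>The exact characteristic\<close>

text \<open>
  By linearity the weights annihilate every polynomial of degree below the number of nodes. The product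
  that vanishes at all nodes but one isolates the weight at that node.
\<close>

lemma sum_mult_monomial_eq_zero_imp:
  fixes \<rho> c :: "nat \<Rightarrow> complex"
  assumes inj: "inj_on \<rho> I" and fin: "finite I"
    and zero: "\<And>i. i < card I \<Longrightarrow> (\<Sum>l\<in>I. c l * \<rho> l ^ i) = 0"
    and l: "l \<in> I"
  shows "c l = 0"
proof -
  define L where "L = (\<Prod>m\<in>I - {l}. [:- \<rho> m, 1:])"
  have "degree L = card I - 1"
    unfolding L_def using fin l by (subst degree_prod_eq_sum_degree) auto
  moreover have "0 < card I" using fin l card_gt_0_iff by blast
  ultimately have deg: "degree L < card I" by simp
  have L_eq_0: "poly L (\<rho> m) = 0" if "m \<in> I - {l}" for m
    unfolding L_def poly_prod using that fin by (intro prod_zero) auto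
  have L_neq_0: "poly L (\<rho> l) \<noteq> 0"
    unfolding L_def poly_prod using fin l inj by (auto simp: prod_zero_iff dest: inj_onD)
  have "(\<Sum>m\<in>I. c m * poly L (\<rho> m)) = (\<Sum>m\<in>I. \<Sum>i\<le>degree L. coeff L i * (c m * \<rho> m ^ i))"
    by (simp add: poly_altdef sum_distrib_left ac_simps)
  also have "\<dots> = (\<Sum>i\<le>degree L. coeff L i * (\<Sum>m\<in>I. c m * \<rho> m ^ i))"
    by (subst sum.swap) (simp add: sum_distrib_left)
  also have "\<dots> = 0" using deg zero by (intro sum.neutral) auto
  finally have "(\<Sum>m\<in>I. c m * poly L (\<rho> m)) = 0" .
  also have "(\<Sum>m\<in>I. c m * poly L (\<rho> m)) = c l * poly L (\<rho> l)"
    using fin l L_eq_0 by (subst sum.remove[of _ l]) auto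
  finally show ?thesis using L_neq_0 by simp
qed

lemma hankel_block_carrier [simp]: "hankel_block r q \<alpha> w s \<in> carrier_mat r r"
  by (simp add: hankel_block_def)

lemma pencil_carrier:
  "H0 \<in> carrier_mat n n \<Longrightarrow> H1 \<in> carrier_mat n n \<Longrightarrow> pencil H0 H1 z \<in> carrier_mat n n"
  unfolding pencil_def by auto

lemma hankel_pencil_index:
  assumes "i < r" "j < r"
  shows "pencil (hankel_block r q \<alpha> w 0) (hankel_block r q \<alpha> w 1) z $$ (i, j)
    = (\<Sum>l=1..r. w l * (node q \<alpha> l - z) * node q \<alpha> l ^ i * node q \<alpha> l ^ j)"
  using assms
  by (simp add: pencil_def hankel_block_def moment_def sum_distrib_left algebra_simps power_add
      sum_subtractf)

text \<open>
  The pencil sends the coefficient vector of a polynomial $p$ to the moments of the weights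
  $w_l (\rho_l - z) p(\rho_l)$. On the kernel these weights vanish, and $p$ has too many roots.
\<close>

lemma hankel_pencil_char_nonzero:
  assumes w: "\<And>l. l \<in> {1..r} \<Longrightarrow> w l \<noteq> 0"
    and inj: "inj_on (node q \<alpha>) {1..r}"
    and z: "\<And>l. l \<in> {1..r} \<Longrightarrow> node q \<alpha> l \<noteq> z"
  shows "pencil_char (hankel_block r q \<alpha> w 0) (hankel_block r q \<alpha> w 1) z \<noteq> 0"
proof
  let ?A = "pencil (hankel_block r q \<alpha> w 0) (hankel_block r q \<alpha> w 1) z"
  let ?\<rho> = "node q \<alpha>"
  have A: "?A \<in> carrier_mat r r" by (simp add: pencil_carrier)
  assume "pencil_char (hankel_block r q \<alpha> w 0) (hankel_block r q \<alpha> w 1) z = 0"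
  then obtain v where v: "v \<in> carrier_vec r" "v \<noteq> 0\<^sub>v r" and Av: "?A *\<^sub>v v = 0\<^sub>v r"
    unfolding pencil_char_def using det_0_iff_vec_prod_zero[OF A] by blast
  define p where "p = (\<Sum>j<r. monom (v $ j) j)"
  have coeff_p: "coeff p j = (if j < r then v $ j else 0)" for j
    unfolding p_def coeff_sum by (simp add: if_distrib cong: if_cong)
  have root: "poly p (?\<rho> l) = 0" if l: "l \<in> {1..r}" for l
  proof -
    let ?c = "\<lambda>l. w l * (?\<rho> l - z) * poly p (?\<rho> l)"
    have "(\<Sum>l=1..r. ?c l * ?\<rho> l ^ i) = 0" if i: "i < r" for i
    proof -
      have "0 = (?A *\<^sub>v v) $ i" using Av i by simp
      also have "\<dots> = (\<Sum>j<r. ?A $$ (i, j) * v $ j)"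
        using A v(1) i by (simp add: scalar_prod_def lessThan_atLeast0)
      also have "\<dots> = (\<Sum>j<r. \<Sum>l=1..r. w l * (?\<rho> l - z) * ?\<rho> l ^ i * ?\<rho> l ^ j * v $ j)"
        using i by (intro sum.cong refl) (simp add: hankel_pencil_index sum_distrib_right del: One_nat_def)
      also have "\<dots> = (\<Sum>l=1..r. ?c l * ?\<rho> l ^ i)"
        by (subst sum.swap) (simp add: p_def poly_sum poly_monom sum_distrib_left
            sum_distrib_right ac_simps)
      finally show ?thesis by simp
    qed
    then have "?c l = 0"
      using sum_mult_monomial_eq_zero_imp[OF inj _ _ l, of ?c] by simp
    then show ?thesis using w[OF l] z[OF l] by simp
  qed
  have "p = 0"
  proof (rule ccontr)
    assume p: "p \<noteq> 0"
    have "r = card (?\<rho> ` {1..r})" using card_image[OF inj] by simp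
    also have "\<dots> \<le> card {x. poly p x = 0}"
      using root poly_roots_finite[OF p] by (intro card_mono) auto
    also have "\<dots> \<le> degree p" using p by (rule poly_roots_degree)
    finally have "coeff p (degree p) = 0" using coeff_p by simp
    then show False using p by simp
  qed
  then have "v = 0\<^sub>v r" using coeff_p v(1) by (intro eq_vecI) (auto, metis coeff_0)
  then show False using v(2) by simp
qed

section \<open>Counting zeros on a contour\<close>

text \<open>
  Expressing the characteristic as a polynomial yields holomorphy, continuity and the finiteness of the zero
  set of a nonzero characteristic at once.
\<close>

lemma pencil_char_eq_poly:
  assumes H0: "H0 \<in> carrier_mat n n" and H1: "H1 \<in> carrier_mat n n"
  obtains p where "\<And>z. pencil_char H0 H1 z = poly p z"
proof
  fix z
  show "pencil_char H0 H1 z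
      = poly (Determinant.det (Matrix.mat n n (\<lambda>ij. [:H1 $$ ij, - (H0 $$ ij):]))) z"
    unfolding pencil_char_def
    by (rule poly_det_cong[symmetric, of _ n]) (use H0 H1 in \<open>auto simp: pencil_def\<close>)
qed

lemma compact_path_image_contour:
  assumes "pos_simple_closed_C1 \<gamma>"
  shows "compact (path_image \<gamma>)" "path_image \<gamma> \<noteq> {}"
  using assms unfolding pos_simple_closed_C1_def
  by (simp_all add: compact_simple_path_image simple_path_imp_path)

text \<open>
  Rouche's theorem on the whole plane counts zeros weighted by winding numbers, and these turn the sum
  over all zeros into the sum over the zeros in the interior.
\<close>

lemma same_zero_count_polys:
  assumes \<gamma>: "pos_simple_closed_C1 \<gamma>"
    and less: "\<And>z. z \<in> path_image \<gamma> \<Longrightarrow> cmod (poly p' z - poly p z) < cmod (poly p z)"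
  shows "same_zero_count (poly p') (poly p) (inside (path_image \<gamma>))"
proof -
  let ?I = "inside (path_image \<gamma>)"
  have C1: "\<gamma> C1_differentiable_on {0..1}" and simple: "simple_path \<gamma>"
    and loop: "pathfinish \<gamma> = pathstart \<gamma>"
    and inside1: "\<And>z. z \<in> ?I \<Longrightarrow> winding_number \<gamma> z = 1"
    using \<gamma> unfolding pos_simple_closed_C1_def by auto
  have path: "path \<gamma>" using simple by (rule simple_path_imp_path)
  have valid: "valid_path \<gamma>"
    unfolding valid_path_def using C1 by (rule C1_differentiable_imp_piecewise)
  have nz: "poly p z \<noteq> 0" "poly p' z \<noteq> 0" if "z \<in> path_image \<gamma>" for z
    using less[OF that] by auto
  obtain z0 where z0: "z0 \<in> path_image \<gamma>" using compact_path_image_contour(2)[OF \<gamma>] by auto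
  have fin: "finite {z. poly p z = 0}" "finite {z. poly p' z = 0}"
    using nz[OF z0] by (auto intro!: poly_roots_finite)
  have count: "(\<Sum>z | z \<in> UNIV \<and> poly f z = 0. winding_number \<gamma> z * of_int (zorder (poly f) z))
      = of_int (\<Sum>z | z \<in> ?I \<and> poly f z = 0. zorder (poly f) z)"
    if f: "finite {z. poly f z = 0}" "\<And>z. z \<in> path_image \<gamma> \<Longrightarrow> poly f z \<noteq> 0" for f
  proof -
    have out: "winding_number \<gamma> z = 0" if "z \<notin> ?I" "poly f z = 0" for z
    proof -
      have "z \<in> outside (path_image \<gamma>)"
        using inside_Un_outside[of "path_image \<gamma>"] that f(2) by blast
      then show ?thesis by (rule winding_number_zero_in_outside[OF path loop])
    qed
    have "(\<Sum>z | z \<in> UNIV \<and> poly f z = 0. winding_number \<gamma> z * of_int (zorder (poly f) z))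
        = (\<Sum>z | z \<in> ?I \<and> poly f z = 0. winding_number \<gamma> z * of_int (zorder (poly f) z))"
      using f(1) out by (intro sum.mono_neutral_right) auto
    also have "\<dots> = (\<Sum>z | z \<in> ?I \<and> poly f z = 0. of_int (zorder (poly f) z))"
      using inside1 by (intro sum.cong) auto
    finally show ?thesis by simp
  qed
  have "(\<Sum>z | z \<in> UNIV \<and> poly p z + poly (p' - p) z = 0.
          winding_number \<gamma> z * of_int (zorder (\<lambda>z. poly p z + poly (p' - p) z) z))
      = (\<Sum>z | z \<in> UNIV \<and> poly p z = 0. winding_number \<gamma> z * of_int (zorder (poly p) z))"
    using fin less valid loop
    by (intro Rouche_theorem) (auto intro!: holomorphic_intros)
  then have "(\<Sum>z | z \<in> UNIV \<and> poly p' z = 0. winding_number \<gamma> z * of_int (zorder (poly p') z))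
      = (\<Sum>z | z \<in> UNIV \<and> poly p z = 0. winding_number \<gamma> z * of_int (zorder (poly p) z))"
    by simp
  then have "(\<Sum>z | z \<in> ?I \<and> poly p' z = 0. zorder (poly p') z)
      = (\<Sum>z | z \<in> ?I \<and> poly p z = 0. zorder (poly p) z)"
    using count[OF fin(1) nz(1)] count[OF fin(2) nz(2)] of_int_eq_iff by metis
  moreover have "finite {z \<in> ?I. poly p' z = 0}" "finite {z \<in> ?I. poly p z = 0}"
    using fin by auto
  ultimately show ?thesis unfolding same_zero_count_def by blast
qed

section \<open>Boundedness along the contour\<close>

lemma continuous_on_det:
  assumes F: "\<And>z. z \<in> S \<Longrightarrow> F z \<in> carrier_mat n n"
    and cont: "\<And>i j. i < n \<Longrightarrow> j < n \<Longrightarrow> continuous_on S (\<lambda>z. F z $$ (i, j))"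
  shows "continuous_on S (\<lambda>z. Determinant.det (F z) :: complex)"
proof -
  have "continuous_on S (\<lambda>z. \<Sum>p | p permutes {0..<n}. signof p * (\<Prod>i=0..<n. F z $$ (i, p i)))"
    by (intro continuous_intros cont) (auto simp: permutes_in_image)
  then show ?thesis by (rule continuous_on_eq) (simp add: det_def'[OF F])
qed

lemma continuous_on_adj_mat_entry:
  assumes F: "\<And>z. z \<in> S \<Longrightarrow> F z \<in> carrier_mat n n"
    and cont: "\<And>i j. i < n \<Longrightarrow> j < n \<Longrightarrow> continuous_on S (\<lambda>z. F z $$ (i, j) :: complex)"
    and ij: "i < n" "j < n"
  shows "continuous_on S (\<lambda>z. adj_mat (F z) $$ (i, j))"
proof -
  have "continuous_on S (\<lambda>z. (-1) ^ (j + i) * Determinant.det (mat_delete (F z) j i))"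
  proof (intro continuous_intros continuous_on_det)
    fix z assume "z \<in> S"
    then show "mat_delete (F z) j i \<in> carrier_mat (n - 1) (n - 1)"
      using F by (intro mat_delete_carrier)
  next
    fix k l assume kl: "k < n - 1" "l < n - 1"
    have "continuous_on S (\<lambda>z. F z $$ (if k < j then k else Suc k, if l < i then l else Suc l))"
      using kl by (intro cont) auto
    then show "continuous_on S (\<lambda>z. mat_delete (F z) j i $$ (k, l))"
      by (rule continuous_on_eq) (use F kl in \<open>force simp: mat_delete_def\<close>)
  qed
  then show ?thesis
    by (rule continuous_on_eq) (use F ij in \<open>force simp: adj_mat_def cofactor_def\<close>)
qed

text \<open>
  The sum of the moduli of the entries dominates the spectral norm. By the adjugate formula that sum is
  continuous, hence bounded on a compact set.
\<close>

lemma bdd_above_spectral_norm_inverse_mult: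
  assumes S: "compact S"
    and F: "\<And>z. z \<in> S \<Longrightarrow> F z \<in> carrier_mat n n"
    and G: "\<And>z. z \<in> S \<Longrightarrow> G z \<in> carrier_mat n n"
    and det: "\<And>z. z \<in> S \<Longrightarrow> Determinant.det (F z) \<noteq> 0"
    and contF: "\<And>i j. i < n \<Longrightarrow> j < n \<Longrightarrow> continuous_on S (\<lambda>z. F z $$ (i, j))"
    and contG: "\<And>i j. i < n \<Longrightarrow> j < n \<Longrightarrow> continuous_on S (\<lambda>z. G z $$ (i, j))"
  shows "bdd_above ((\<lambda>z. spectral_norm (inverse_matrix (F z) * G z)) ` S)"
proof -
  define N where "N = (\<lambda>z. \<Sum>i<n. \<Sum>j<n. cmod (\<Sum>k<n.
    1 / Determinant.det (F z) * adj_mat (F z) $$ (i, k) * G z $$ (k, j)))"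
  have "continuous_on S N"
    unfolding N_def
    by (intro continuous_intros continuous_on_det[OF F] continuous_on_adj_mat_entry[OF F] contF contG)
      (use det in auto)
  then have "bounded (N ` S)" using S compact_continuous_image compact_imp_bounded by blast
  then obtain b where b: "\<And>z. z \<in> S \<Longrightarrow> N z \<le> b"
    using bounded_imp_bdd_above by (force simp: bdd_above_def)
  have "spectral_norm (inverse_matrix (F z) * G z) \<le> b" if z: "z \<in> S" for z
  proof -
    note inv = inverse_matrix_eq[OF F[OF z] det[OF z]]
    have "(inverse_matrix (F z) * G z) $$ (i, j)
        = (\<Sum>k<n. 1 / Determinant.det (F z) * adj_mat (F z) $$ (i, k) * G z $$ (k, j))"
      if "i < n" "j < n" for i j
      using that inv(1) G[OF z] adj_mat(1)[OF F[OF z]] unfolding inv(4)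
      by (simp add: scalar_prod_def lessThan_atLeast0)
    then have "N z = (\<Sum>i<n. \<Sum>j<n. cmod ((inverse_matrix (F z) * G z) $$ (i, j)))"
      by (simp add: N_def)
    also have "\<dots> \<ge> spectral_norm (inverse_matrix (F z) * G z)"
      using spectral_norm_le_entries[of "inverse_matrix (F z) * G z"] inv(1) G[OF z] by simp
    finally show ?thesis using b[OF z] by simp
  qed
  then show ?thesis by (auto intro!: bdd_aboveI)
qed

section \<open>The three criteria\<close>

lemma pencil_add:
  assumes "H0 \<in> carrier_mat n n" "H1 \<in> carrier_mat n n" "D0 \<in> carrier_mat n n" "D1 \<in> carrier_mat n n"
  shows "pencil (H0 + D0) (H1 + D1) z = pencil H0 H1 z + pencil D0 D1 z"
  unfolding pencil_def using assms by (intro eq_matI) (auto simp: algebra_simps)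

lemma spectral_norm_pencil_le:
  assumes D0: "D0 \<in> carrier_mat n n" and D1: "D1 \<in> carrier_mat n n"
  shows "spectral_norm (pencil D0 D1 z) \<le> spectral_norm D1 + cmod z * spectral_norm D0"
proof (rule spectral_norm_least)
  fix v :: "complex Matrix.vec" assume "v \<in> carrier_vec (dim_col (pencil D0 D1 z))"
  then have v: "v \<in> carrier_vec n" using pencil_carrier[OF D0 D1, of z] by simp
  have "pencil D0 D1 z *\<^sub>v v = D1 *\<^sub>v v + (- z) \<cdot>\<^sub>v (D0 *\<^sub>v v)"
    unfolding pencil_def using D0 D1 v
    by (intro eq_vecI) (auto simp: minus_scalar_prod_distrib[of _ n] scalar_prod_def sum_distrib_left
        sum_subtractf sum_negf algebra_simps)
  then have "euclid_norm (pencil D0 D1 z *\<^sub>v v)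
      \<le> euclid_norm (D1 *\<^sub>v v) + cmod z * euclid_norm (D0 *\<^sub>v v)"
    using euclid_norm_add[of "D1 *\<^sub>v v" n "(- z) \<cdot>\<^sub>v (D0 *\<^sub>v v)"] D0 D1 v
    by (simp add: euclid_norm_smult)
  also have "\<dots> \<le> spectral_norm D1 * euclid_norm v + cmod z * (spectral_norm D0 * euclid_norm v)"
    using euclid_norm_mult_le_spectral_norm[of v D1] euclid_norm_mult_le_spectral_norm[of v D0] D0 D1 v
    by (intro add_mono mult_left_mono) auto
  finally show "euclid_norm (pencil D0 D1 z *\<^sub>v v)
      \<le> (spectral_norm D1 + cmod z * spectral_norm D0) * euclid_norm v"
    by (simp add: algebra_simps)
qed (simp add: spectral_norm_nonneg)

theorem theorem4p3:
  fixes r :: nat and q :: real and \<alpha> w :: "nat \<Rightarrow> complex"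
    and \<gamma> :: "real \<Rightarrow> complex" and \<Delta>0 \<Delta>1 :: "complex mat"
  defines "H0 \<equiv> hankel_block r q \<alpha> w 0"
    and "H1 \<equiv> hankel_block r q \<alpha> w 1"
  defines "A \<equiv> pencil H0 H1"
    and "\<Psi> \<equiv> pencil_char H0 H1"
    and "\<Psi>' \<equiv> pencil_char (H0 + \<Delta>0) (H1 + \<Delta>1)"
  assumes r: "1 \<le> r"
    and q: "0 < q" "q < 1"
    and w: "\<And>l. l \<in> {1..r} \<Longrightarrow> w l \<noteq> 0"
    and distinct_nodes: "inj_on (node q \<alpha>) {1..r}"
    and contour: "pos_simple_closed_C1 \<gamma>"
    and avoid: "\<And>l. l \<in> {1..r} \<Longrightarrow> node q \<alpha> l \<notin> path_image \<gamma>"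
    and \<Delta>: "\<Delta>0 \<in> carrier_mat r r" "\<Delta>1 \<in> carrier_mat r r"
  shows
    "((SUP z\<in>path_image \<gamma>. cmod (\<Psi>' z - \<Psi> z)) < contour_margin \<Psi> \<gamma>
        \<longrightarrow> same_zero_count \<Psi>' \<Psi> (inside (path_image \<gamma>))) \<and>
     ((SUP z\<in>path_image \<gamma>. spectral_norm (inverse_matrix (A z) * (\<Delta>1 - z \<cdot>\<^sub>m \<Delta>0)))
          < 2 powr (1 / real r) - 1
        \<longrightarrow> same_zero_count \<Psi>' \<Psi> (inside (path_image \<gamma>))) \<and>
     (spectral_norm \<Delta>1 + contour_radius \<gamma> * spectral_norm \<Delta>0
          < (2 powr (1 / real r) - 1) * sigma_margin A \<gamma>
        \<longrightarrow> same_zero_count \<Psi>' \<Psi> (inside (path_image \<gamma>)))"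
proof -
  let ?S = "path_image \<gamma>" and ?B = "pencil \<Delta>0 \<Delta>1" and ?\<epsilon> = "2 powr (1 / real r) - 1"
  have H: "H0 \<in> carrier_mat r r" "H1 \<in> carrier_mat r r" by (simp_all add: H0_def H1_def)
  have A: "A z \<in> carrier_mat r r" and B: "?B z \<in> carrier_mat r r" for z
    unfolding A_def using H \<Delta> by (auto intro: pencil_carrier)
  have compact: "compact ?S" and S_ne: "?S \<noteq> {}"
    using compact_path_image_contour[OF contour] by auto
  obtain p where p: "\<Psi> = poly p"
    using pencil_char_eq_poly[OF H] unfolding \<Psi>_def by (metis ext)
  obtain p' where p': "\<Psi>' = poly p'"
    using pencil_char_eq_poly[of "H0 + \<Delta>0" r "H1 + \<Delta>1"] H \<Delta> unfolding \<Psi>'_def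
    by (metis ext add_carrier_mat)
  have rouche: "same_zero_count \<Psi>' \<Psi> (inside ?S)"
    if "\<And>z. z \<in> ?S \<Longrightarrow> cmod (\<Psi>' z - \<Psi> z) < cmod (\<Psi> z)"
    using same_zero_count_polys[OF contour, of p' p] that unfolding p p' by blast
  have \<Psi>_det: "\<Psi> z = Determinant.det (A z)" for z by (simp add: \<Psi>_def A_def pencil_char_def)
  have \<Psi>'_det: "\<Psi>' z = Determinant.det (A z + ?B z)" for z
    using pencil_add[OF H \<Delta>] by (simp add: \<Psi>'_def A_def pencil_char_def)
  have det: "Determinant.det (A z) \<noteq> 0" if "z \<in> ?S" for z
  proof -
    have "pencil_char H0 H1 z \<noteq> 0"
      unfolding H0_def H1_def using avoid that w
      by (intro hankel_pencil_char_nonzero distinct_nodes) auto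
    then show ?thesis by (simp add: pencil_char_def A_def)
  qed
  have relative: "same_zero_count \<Psi>' \<Psi> (inside ?S)"
    if "\<And>z. z \<in> ?S \<Longrightarrow> spectral_norm (inverse_matrix (A z) * ?B z) < ?\<epsilon>"
    using det_perturbation_less[OF A B r det that] by (intro rouche) (simp add: \<Psi>_det \<Psi>'_det)
  have 1: "same_zero_count \<Psi>' \<Psi> (inside ?S)"
    if less: "(SUP z\<in>?S. cmod (\<Psi>' z - \<Psi> z)) < contour_margin \<Psi> \<gamma>"
  proof (rule rouche)
    fix z assume z: "z \<in> ?S"
    have "compact ((\<lambda>z. cmod (\<Psi>' z - \<Psi> z)) ` ?S)"
      unfolding p p' by (intro compact_continuous_image continuous_intros compact)
    then have "bdd_above ((\<lambda>z. cmod (\<Psi>' z - \<Psi> z)) ` ?S)"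
      by (intro bounded_imp_bdd_above compact_imp_bounded)
    then have "cmod (\<Psi>' z - \<Psi> z) \<le> (SUP z\<in>?S. cmod (\<Psi>' z - \<Psi> z))"
      using z by (intro cSUP_upper)
    also have "\<dots> < contour_margin \<Psi> \<gamma>" by (rule less)
    also have "\<dots> \<le> cmod (\<Psi> z)"
      unfolding contour_margin_def using z by (intro cINF_lower bdd_belowI[of _ 0]) auto
    finally show "cmod (\<Psi>' z - \<Psi> z) < cmod (\<Psi> z)" .
  qed
  have 2: "same_zero_count \<Psi>' \<Psi> (inside ?S)"
    if less: "(SUP z\<in>?S. spectral_norm (inverse_matrix (A z) * (\<Delta>1 - z \<cdot>\<^sub>m \<Delta>0))) < ?\<epsilon>"
  proof (rule relative)
    fix z assume z: "z \<in> ?S"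
    have "bdd_above ((\<lambda>z. spectral_norm (inverse_matrix (A z) * ?B z)) ` ?S)"
    proof (rule bdd_above_spectral_norm_inverse_mult[OF compact A B det])
      fix i j assume "i < r" "j < r"
      then show "continuous_on ?S (\<lambda>z. A z $$ (i, j))" "continuous_on ?S (\<lambda>z. ?B z $$ (i, j))"
        using H \<Delta> unfolding A_def pencil_def by (auto intro!: continuous_intros)
    qed
    then have "spectral_norm (inverse_matrix (A z) * ?B z)
        \<le> (SUP z\<in>?S. spectral_norm (inverse_matrix (A z) * ?B z))"
      using z by (intro cSUP_upper)
    then show "spectral_norm (inverse_matrix (A z) * ?B z) < ?\<epsilon>"
      using less unfolding pencil_def by linarith
  qed
  have 3: "same_zero_count \<Psi>' \<Psi> (inside ?S)"
    if less: "spectral_norm \<Delta>1 + contour_radius \<gamma> * spectral_norm \<Delta>0 < ?\<epsilon> * sigma_margin A \<gamma>"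
  proof (rule relative)
    fix z assume z: "z \<in> ?S"
    have \<epsilon>: "0 < ?\<epsilon>" using r by simp
    have "bdd_above (cmod ` ?S)"
      by (intro bounded_imp_bdd_above compact_imp_bounded compact_continuous_image
          continuous_intros compact)
    then have R: "cmod z \<le> contour_radius \<gamma>"
      unfolding contour_radius_def using z by (intro cSUP_upper)
    have \<sigma>: "sigma_margin A \<gamma> \<le> sigma_min (A z)"
      unfolding sigma_margin_def using z sigma_min_nonneg[OF A r]
      by (intro cINF_lower bdd_belowI[of _ 0]) auto
    have "spectral_norm (?B z) \<le> spectral_norm \<Delta>1 + cmod z * spectral_norm \<Delta>0"
      by (rule spectral_norm_pencil_le[OF \<Delta>])
    also have "\<dots> \<le> spectral_norm \<Delta>1 + contour_radius \<gamma> * spectral_norm \<Delta>0"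
      using R spectral_norm_nonneg[of \<Delta>0] by (simp add: mult_right_mono)
    also have "\<dots> < ?\<epsilon> * sigma_margin A \<gamma>" by (rule less)
    also have "\<dots> \<le> ?\<epsilon> * sigma_min (A z)" using \<sigma> \<epsilon> by simp
    finally have B_less: "spectral_norm (?B z) < ?\<epsilon> * sigma_min (A z)" .
    then have "0 < ?\<epsilon> * sigma_min (A z)" using spectral_norm_nonneg[of "?B z"] by linarith
    then have pos: "0 < sigma_min (A z)" using \<epsilon> by (simp add: zero_less_mult_iff)
    have "spectral_norm (inverse_matrix (A z) * ?B z) \<le> spectral_norm (?B z) / sigma_min (A z)"
      by (rule spectral_norm_inverse_mult_le[OF A B r det[OF z] pos])
    also have "\<dots> < ?\<epsilon>" using B_less pos by (simp add: divide_less_eq)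
    finally show "spectral_norm (inverse_matrix (A z) * ?B z) < ?\<epsilon>" .
  qed
  show ?thesis using 1 2 3 by blast
qed

end
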